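(* Let $c$ be an integer such that $c\ge 3$ and $c\not\equiv 1\pmod 3$. Then there is exactly one Arf numerical semigroup $S$ with multiplicity $3$ and conductor $c$, given by (i) $S=\langle 3,c+1,c+2\rangle$ if $c\equiv 0\pmod 3$, (ii) $S=\langle 3,c,c+2\rangle$ if $c\equiv 2\pmod 3$.
   Context: A numerical semigroup is a submonoid $S$ of $(\mathbb N,+)$ ($\mathbb N$ the nonnegative integers) with finite complement in $\mathbb N$. Its multiplicity is the least positive integer in $S$, and its conductor is $\max(\mathbb Z\setminus S)+1$. $S$ is an Arf numerical semigroup if $x+y-z\in S$ for all $x,y,z\in S$ with $x\ge y\ge z$. $\langle A\rangle$ denotes the submonoid of $\mathbb N$ generated by $A$. *)

theory Defs
  imports Complex_Main "HOL-Number_Theory.Cong"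
begin

definition nat_submonoid :: "nat set \<Rightarrow> bool" where
  "nat_submonoid S \<longleftrightarrow> 0 \<in> S \<and> (\<forall>x\<in>S. \<forall>y\<in>S. x + y \<in> S)"

definition numerical_semigroup :: "nat set \<Rightarrow> bool" where
  "numerical_semigroup S \<longleftrightarrow> nat_submonoid S \<and> finite (UNIV - S)"

definition semigroup_multiplicity :: "nat set \<Rightarrow> nat" where
  "semigroup_multiplicity S = (LEAST n. n \<in> S \<and> 0 < n)"

(* The complement is taken in the integers, so it is never empty; it contains every negative
   integer and hence is infinite, which rules out the operator Max. For a numerical semigroup
   the complement is bounded above, so the greatest element exists. *)
definition conductor :: "nat set \<Rightarrow> int" where
  "conductor S = (GREATEST z::int. z \<in> UNIV - int ` S) + 1"

(* The subtraction on nat never truncates here, because z \<le> x + y. *)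
definition arf_numerical_semigroup :: "nat set \<Rightarrow> bool" where
  "arf_numerical_semigroup S \<longleftrightarrow> numerical_semigroup S \<and>
     (\<forall>x\<in>S. \<forall>y\<in>S. \<forall>z\<in>S. x \<ge> y \<and> y \<ge> z \<longrightarrow> x + y - z \<in> S)"

definition generated_submonoid :: "nat set \<Rightarrow> nat set" where
  "generated_submonoid A = nat_submonoid hull A"

end

theory Submission
  imports Defs
begin

text \<open>
  The conditions on \<open>S\<close> say that \<open>S\<close> contains all multiples of 3 and everything from \<open>c\<close> on,
  but neither 1, 2 nor \<open>c - 1\<close>. If some \<open>x \<in> S\<close> below \<open>c\<close> is not a multiple of 3, write
  \<open>x = 3 k + r\<close> with \<open>r \<in> {1, 2}\<close>; the Arf property gives \<open>2 x - 3 k = 3 k + 2 r \<in> S\<close>, so, as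
  \<open>c - 1\<close> is not a multiple of 3, one of \<open>x\<close> and \<open>2 x - 3 k\<close> is congruent to it modulo 3 and at most \<open>c - 1\<close>; adding multiples of 3 yields
  \<open>c - 1 \<in> S\<close>, a contradiction. Hence \<open>S\<close> consists of the multiples of 3 and the numbers \<open>\<ge> c\<close>.
\<close>

definition multiples_or_above :: "nat \<Rightarrow> nat \<Rightarrow> nat set" where
  "multiples_or_above m n = {x. m dvd x \<or> n \<le> x}"

text \<open>The integer complement consists of the gaps of \<open>S\<close> and all negative
  integers, so its greatest element is the maximum of the finitely many gaps with \<open>-1\<close>
  adjoined. The \<open>-1\<close> covers \<open>S = UNIV\<close>, where the conductor is 0.\<close>

lemma conductor_eq_iff:
  assumes "finite (UNIV - S)"
  shows "conductor S = c \<longleftrightarrow> c - 1 \<notin> int ` S \<and> (\<forall>z\<ge>c. z \<in> int ` S)"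
proof -
  let ?B = "insert (-1) (int ` (UNIV - S))"
  let ?m = "Max ?B"
  have fin: "finite ?B" using assms by simp
  have notin: "?m \<notin> int ` S" using Max_in[OF fin] by fastforce
  have above: "z \<in> int ` S" if "z > ?m" for z
  proof -
    have "z > -1" and "z \<notin> ?B" using that fin by (auto simp: not_less[symmetric])
    then show ?thesis by (cases z) auto
  qed
  have "(GREATEST z. z \<in> UNIV - int ` S) = ?m"
    using notin above by (intro Greatest_equality) (auto simp: not_less[symmetric])
  then have cond: "conductor S = ?m + 1" by (simp add: conductor_def)
  show ?thesis
  proof
    assume "conductor S = c"
    then show "c - 1 \<notin> int ` S \<and> (\<forall>z\<ge>c. z \<in> int ` S)"
      using cond notin above by auto
  next
    assume c: "c - 1 \<notin> int ` S \<and> (\<forall>z\<ge>c. z \<in> int ` S)"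
    have "\<not> c - 1 > ?m" using above c by blast
    moreover have "\<not> ?m \<ge> c" using notin c by blast
    ultimately show "conductor S = c" using cond by linarith
  qed
qed

lemma nat_submonoid_mult:
  assumes "nat_submonoid S" "x \<in> S"
  shows "k * x \<in> S"
  using assms by (induction k) (auto simp: nat_submonoid_def)

lemma nat_submonoid_add_mult:
  assumes "nat_submonoid S" "x \<in> S" "y \<in> S"
  shows "x + k * y \<in> S"
  using assms nat_submonoid_mult[OF assms(1,3)] by (auto simp: nat_submonoid_def)

lemma nat_submonoid_up:
  assumes "nat_submonoid S" "m \<in> S" "x \<in> S" "x \<le> y" "y mod m = x mod m"
  shows "y \<in> S"
proof -
  have "m dvd y - x" using assms(4,5) by (simp add: mod_eq_dvd_iff_nat)
  then obtain k where "y - x = m * k" ..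
  then have "y = x + k * m" using assms(4) by (simp add: mult.commute)
  then show ?thesis using nat_submonoid_add_mult[OF assms(1,3,2)] by simp
qed

text \<open>Distinct congruent numbers differ by at least \<open>m\<close>, so \<open>x < a\<close>
  would give \<open>x + m \<le> a\<close>.\<close>

lemma le_of_cong_less:
  fixes a x m :: nat
  assumes "x mod m = a mod m" "a < x + m"
  shows "a \<le> x"
proof (rule ccontr)
  assume "\<not> a \<le> x"
  then have "m dvd a - x" using assms(1) mod_eq_dvd_iff_nat[of x a m] by simp
  then show False using \<open>\<not> a \<le> x\<close> assms(2) by (auto dest: dvd_imp_le)
qed

lemma nat_submonoid_generated: "nat_submonoid (generated_submonoid A)"
  unfolding generated_submonoid_def
  \<comment> \<open>The hull has the property because submonoids are closed under
    intersection.\<close>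
  by (rule hull_in) (auto simp: nat_submonoid_def)

lemma nat_submonoid_multiples_or_above: "nat_submonoid (multiples_or_above m n)"
  by (auto simp: nat_submonoid_def multiples_or_above_def)

lemma finite_Compl_multiples_or_above: "finite (UNIV - multiples_or_above m n)"
  by (rule finite_subset[of _ "{..<n}"]) (auto simp: multiples_or_above_def)

text \<open>If \<open>n \<le> x\<close>, then \<open>x + y - z \<ge> x \<ge> n\<close>, since
  \<open>y \<ge> z\<close>. Otherwise \<open>x\<close>, \<open>y\<close> and \<open>z\<close> all
  lie below \<open>n\<close>, hence are multiples of \<open>m\<close>.\<close>

lemma arf_multiples_or_above: "arf_numerical_semigroup (multiples_or_above m n)"
proof -
  have "x + y - z \<in> multiples_or_above m n"
    if "x \<in> multiples_or_above m n" "y \<in> multiples_or_above m n" "z \<in> multiples_or_above m n"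
      "x \<ge> y" "y \<ge> z" for x y z
  proof (cases "n \<le> x")
    case True
    then show ?thesis using that by (auto simp: multiples_or_above_def)
  next
    case False
    then have "m dvd x" "m dvd y" "m dvd z" using that by (auto simp: multiples_or_above_def)
    then show ?thesis by (auto simp: multiples_or_above_def intro: dvd_diff_nat)
  qed
  then show ?thesis
    by (auto simp: arf_numerical_semigroup_def numerical_semigroup_def
        nat_submonoid_multiples_or_above finite_Compl_multiples_or_above)
qed

lemma multiplicity_multiples_or_above:
  assumes "0 < m" "m \<le> n"
  shows "semigroup_multiplicity (multiples_or_above m n) = m"
  unfolding semigroup_multiplicity_def
  using assms by (intro Least_equality) (auto simp: multiples_or_above_def dest: dvd_imp_le)

lemma conductor_multiples_or_above:
  assumes "0 < n" "\<not> m dvd n - 1"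
  shows "conductor (multiples_or_above m n) = int n"
proof -
  have "z \<in> int ` multiples_or_above m n" if "z \<ge> int n" for z
    using that by (intro image_eqI[of _ _ "nat z"]) (auto simp: multiples_or_above_def)
  moreover have "int n - 1 \<notin> int ` multiples_or_above m n"
  proof
    assume "int n - 1 \<in> int ` multiples_or_above m n"
    then obtain x where "x \<in> multiples_or_above m n" "x = n - 1"
      by (metis imageE int_ops(6) nat_int of_nat_1 nat_minus_as_int)
    then show False using assms by (auto simp: multiples_or_above_def)
  qed
  ultimately show ?thesis
    by (simp add: conductor_eq_iff finite_Compl_multiples_or_above)
qed

lemma arf_multiplicity_3_eq:
  assumes arf: "arf_numerical_semigroup S" and mult: "semigroup_multiplicity S = 3"
    and cond: "conductor S = int n" and n: "3 \<le> n" "n mod 3 \<noteq> 1"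
  shows "S = multiples_or_above 3 n"
proof -
  have mon: "nat_submonoid S" and fin: "finite (UNIV - S)"
    and arfD: "\<And>x y z. x \<in> S \<Longrightarrow> y \<in> S \<Longrightarrow> z \<in> S \<Longrightarrow> x \<ge> y \<Longrightarrow> y \<ge> z \<Longrightarrow> x + y - z \<in> S"
    using arf by (auto simp: arf_numerical_semigroup_def numerical_semigroup_def)
  have "int n - 1 \<notin> int ` S" and above': "\<And>z. z \<ge> int n \<Longrightarrow> z \<in> int ` S"
    using cond fin by (auto simp: conductor_eq_iff)
  then have gap: "n - 1 \<notin> S" using n by (force simp: of_nat_diff)
  have above: "x \<in> S" if "n \<le> x" for x using above'[of "int x"] that by auto
  \<comment> \<open>The element \<open>n\<close> shows that \<open>S\<close> has a positive member,
    so the \<open>LEAST\<close> is attained.\<close>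
  have 3: "3 \<in> S"
    using LeastI[of "\<lambda>x. x \<in> S \<and> 0 < x" n] above n mult
    by (simp add: semigroup_multiplicity_def)
  have dvd: "x \<in> S" if "3 dvd x" for x
    using that nat_submonoid_mult[OF mon 3] by (metis dvdE mult.commute)
  have "3 dvd x" if x: "x \<in> S" "x < n" for x
  proof (rule ccontr)
    assume "\<not> 3 dvd x"
    have r: "x mod 3 = 1 \<or> x mod 3 = 2" using \<open>\<not> 3 dvd x\<close> by presburger
    \<comment> \<open>The Arf property is used with \<open>z\<close> the largest multiple of 3 below
      \<open>x\<close>; this doubles the residue of \<open>x\<close>.\<close>
    have "x + x - 3 * (x div 3) \<in> S" using arfD[of x x "3 * (x div 3)"] x dvd by simp
    moreover have "x + x - 3 * (x div 3) = x + x mod 3" by presburger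
    ultimately have y: "x + x mod 3 \<in> S" by simp
    \<comment> \<open>From such a \<open>u\<close>, adding multiples of 3 would reach the gap
      \<open>n - 1\<close>.\<close>
    have up: "\<not> (u \<le> n - 1 \<and> (n - 1) mod 3 = u mod 3)" if "u \<in> S" for u
      using nat_submonoid_up[OF mon 3 that] gap by blast
    obtain p where p: "n = Suc p" using n(1) by (cases n) auto
    have "x \<noteq> p" using x gap p by auto
    then have "x < p" using x(2) p by simp
    have "p mod 3 = 1 \<or> p mod 3 = 2"
      using n(2) p by (auto simp: mod_Suc split: if_splits)
    then consider "x mod 3 = p mod 3" | "x mod 3 = 1" "p mod 3 = 2" | "x mod 3 = 2" "p mod 3 = 1"
      using r by metis
    then show False
    proof cases
      case 1
      then show False using up[OF x(1)] \<open>x < p\<close> p by simp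
    next
      case 2
      then have "(x + 1) mod 3 = p mod 3" by (simp add: mod_Suc)
      then show False using up[OF y] \<open>x < p\<close> p 2 by simp
    next
      case 3
      \<comment> \<open>Here \<open>x < p\<close> alone does not give \<open>x + 2 \<le> p\<close>;
        the value \<open>p = x + 1\<close> is excluded because it would be a multiple of 3.\<close>
      have "x + 1 \<noteq> p" using 3 by (auto simp: mod_Suc)
      moreover have "(x + 2) mod 3 = p mod 3" using 3 by (simp add: mod_Suc)
      ultimately show False using up[OF y] \<open>x < p\<close> p 3 by simp
    qed
  qed
  then show ?thesis
    using above dvd by (auto simp: multiples_or_above_def not_less[symmetric])
qed

text \<open>The bounds make \<open>a\<close> and \<open>b\<close> the least numbers from
  \<open>n\<close> on in their residue classes, and these are the two nonzero classes modulo 3.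
  Adding multiples of 3 to \<open>0\<close>, \<open>a\<close> and \<open>b\<close> therefore gives
  every element. Stating \<open>res\<close> with sets allows either order of the residues.\<close>

lemma multiples_or_above_3_eq_generated:
  assumes "a \<ge> n" "b \<ge> n" "a \<le> n + 2" "b \<le> n + 2"
    and res: "{a mod 3, b mod 3} = {1, 2}"
  shows "multiples_or_above 3 n = generated_submonoid {3, a, b}" (is "?T = ?G")
proof
  have "{3, a, b} \<subseteq> ?T" using assms by (auto simp: multiples_or_above_def)
  then show "?G \<subseteq> ?T"
    unfolding generated_submonoid_def
    by (rule hull_minimal) (rule nat_submonoid_multiples_or_above)
next
  have mon: "nat_submonoid ?G" by (rule nat_submonoid_generated)
  have gens: "3 \<in> ?G" "a \<in> ?G" "b \<in> ?G"
    using hull_subset[of "{3, a, b}" nat_submonoid] by (auto simp: generated_submonoid_def)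
  have zero: "0 \<in> ?G" using mon by (simp add: nat_submonoid_def)
  have ab: "a mod 3 = 1 \<and> b mod 3 = 2 \<or> a mod 3 = 2 \<and> b mod 3 = 1"
    using res by (auto simp: doubleton_eq_iff)
  show "?T \<subseteq> ?G"
  proof
    fix x assume "x \<in> ?T"
    then have x: "3 dvd x \<or> n \<le> x" by (simp add: multiples_or_above_def)
    then have "x mod 3 = 0 \<or> x mod 3 = a mod 3 \<and> n \<le> x \<or> x mod 3 = b mod 3 \<and> n \<le> x"
      using ab by presburger
    then consider "x mod 3 = 0" | "x mod 3 = a mod 3" "n \<le> x" | "x mod 3 = b mod 3" "n \<le> x"
      by metis
    then show "x \<in> ?G"
    proof cases
      case 1
      then show ?thesis using nat_submonoid_up[OF mon gens(1) zero, of x] by simp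
    next
      case 2
      \<comment> \<open>From \<open>a \<le> n + 2\<close> and \<open>n \<le> x\<close> follows
        \<open>a < x + 3\<close>.\<close>
      have "a \<le> x" using assms(3) 2 by (intro le_of_cong_less) auto
      then show ?thesis using nat_submonoid_up[OF mon gens(1,2)] 2 by simp
    next
      case 3
      have "b \<le> x" using assms(4) 3 by (intro le_of_cong_less) auto
      then show ?thesis using nat_submonoid_up[OF mon gens(1,3)] 3 by simp
    qed
  qed
qed

theorem proposition17:
  fixes c :: int
  assumes "c \<ge> 3" and "\<not> [c = 1] (mod 3)"
  shows "(\<exists>!S. arf_numerical_semigroup S \<and> semigroup_multiplicity S = 3 \<and> conductor S = c) \<and>
    (\<forall>S. arf_numerical_semigroup S \<and> semigroup_multiplicity S = 3 \<and> conductor S = c \<longrightarrow>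
      ([c = 0] (mod 3) \<longrightarrow> S = generated_submonoid {3, nat (c + 1), nat (c + 2)}) \<and>
      ([c = 2] (mod 3) \<longrightarrow> S = generated_submonoid {3, nat c, nat (c + 2)}))"
proof -
  define n where "n = nat c"
  have c: "c = int n" using assms(1) by (simp add: n_def)
  have res: "c mod 3 = int (n mod 3)" by (simp add: c zmod_int)
  have n: "3 \<le> n" "n mod 3 \<noteq> 1"
    using assms c res by (auto simp: cong_def)
  \<comment> \<open>This is where \<open>c\<close> not being congruent to 1 enters the existence
    part: \<open>n - 1\<close> has to be a gap.\<close>
  then have "\<not> 3 dvd n - 1" by presburger
  then have ex: "arf_numerical_semigroup (multiples_or_above 3 n)"
    "semigroup_multiplicity (multiples_or_above 3 n) = 3"
    "conductor (multiples_or_above 3 n) = c"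
    using n c by (auto simp: arf_multiples_or_above multiplicity_multiples_or_above
        conductor_multiples_or_above)
  have uniq: "S = multiples_or_above 3 n"
    if "arf_numerical_semigroup S \<and> semigroup_multiplicity S = 3 \<and> conductor S = c" for S
    using that n c by (intro arf_multiplicity_3_eq) auto
  have nats: "nat (c + 1) = n + 1" "nat (c + 2) = n + 2" "nat c = n"
    using c by auto
  have gen0: "multiples_or_above 3 n = generated_submonoid {3, nat (c + 1), nat (c + 2)}"
    if "[c = 0] (mod 3)"
  proof -
    have "n mod 3 = 0" using that res by (simp add: cong_def)
    then have "(n + 1) mod 3 = 1" "(n + 2) mod 3 = 2" by presburger+
    then show ?thesis unfolding nats by (intro multiples_or_above_3_eq_generated) auto
  qed
  have gen2: "multiples_or_above 3 n = generated_submonoid {3, nat c, nat (c + 2)}"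
    if "[c = 2] (mod 3)"
  proof -
    have "n mod 3 = 2" using that res by (simp add: cong_def)
    \<comment> \<open>The generators \<open>n\<close> and \<open>n + 2\<close> have residues 2 and
      1; the skipped \<open>n + 1\<close> is a multiple of 3.\<close>
    then have "n mod 3 = 2" "(n + 2) mod 3 = 1" by presburger+
    then show ?thesis unfolding nats by (intro multiples_or_above_3_eq_generated) auto
  qed
  show ?thesis
    using ex uniq gen0 gen2 by blast
qed

end
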